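(* Let $T_n$ be a model tree with branching function $n(r)$, $r\ge0$. Then $T_n$ is stochastically complete if and only if $$\sum_{r=0}^{\infty}\frac{1}{n(r)}=\infty.$$
   Context: All graphs are infinite, locally finite and connected; $d(x,y)$ is the number of edges in a shortest path from $x$ to $y$, $m(x)$ is the valence (number of edges at $x$), and $y\sim x$ means $x,y$ are joined by an edge. A (infinite, locally finite) tree is called model if it contains a vertex $x_0$, the root, such that the valence is constant on each sphere $S_r=\{x: d(x,x_0)=r\}$: $m(x)=m(r)$ for all $x\in S_r$. Its branching function is $n(r)=m(r)-1$ for $r>0$ and $n(0)=m(x_0)$; so $n(r)$ is the number of edges connecting a vertex of $S_r$ to vertices of $S_{r+1}$, and the tree is denoted $T_n$. The combinatorial Laplacian is $\Delta f(x)=\sum_{y\sim x}(f(x)-f(y))$. The heat kernel $p_t(x,y)$ of a graph with vertex set $V$ is the smallest non-negative function on $V\times V\times[0,\infty)$ which is smooth in $t$, satisfies $\Delta p+\frac{\partial p}{\partial t}=0$ (with $\Delta$ in either vertex variable) and $p_0(x,y)=\delta_x(y)$. The graph is stochastically incomplete if $\sum_{y\in V}p_{t_0}(x_0,y)<1$ for some vertex $x_0$ and some $t_0>0$, and stochastically complete otherwise. *)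

theory Defs
  imports "HOL-Analysis.Analysis"
begin

text \<open>
  A graph is given by a vertex set \<open>V\<close> and an adjacency relation \<open>E\<close>, so it is undirected and
  has neither loops nor multiple edges.
\<close>

locale infinite_graph =
  fixes V :: "'a set" and E :: "'a \<Rightarrow> 'a \<Rightarrow> bool"
  assumes adj_in_V: "E x y \<Longrightarrow> x \<in> V \<and> y \<in> V"
    and adj_sym: "E x y \<Longrightarrow> E y x"
    and adj_irrefl: "\<not> E x x"
    and infinite_V: "infinite V"
    and locally_finite: "x \<in> V \<Longrightarrow> finite {y. E x y}"
    and connected: "x \<in> V \<Longrightarrow> y \<in> V \<Longrightarrow> E\<^sup>*\<^sup>* x y"

definition valence :: "('a \<Rightarrow> 'a \<Rightarrow> bool) \<Rightarrow> 'a \<Rightarrow> nat"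
  where "valence E x = card {y. E x y}"

definition graph_dist :: "('a \<Rightarrow> 'a \<Rightarrow> bool) \<Rightarrow> 'a \<Rightarrow> 'a \<Rightarrow> nat"
  where "graph_dist E x y = (LEAST k. (E ^^ k) x y)"

definition sphere_at :: "'a set \<Rightarrow> ('a \<Rightarrow> 'a \<Rightarrow> bool) \<Rightarrow> 'a \<Rightarrow> nat \<Rightarrow> 'a set"
  where "sphere_at V E x\<^sub>0 r = {x \<in> V. graph_dist E x x\<^sub>0 = r}"

definition is_cycle :: "('a \<Rightarrow> 'a \<Rightarrow> bool) \<Rightarrow> 'a list \<Rightarrow> bool"
  where "is_cycle E xs \<longleftrightarrow>
    3 \<le> length xs \<and> distinct xs \<and> successively E xs \<and> E (last xs) (hd xs)"

locale infinite_tree = infinite_graph +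
  assumes acyclic: "\<not> is_cycle E xs"

locale model_tree = infinite_tree V E for V :: "'a set" and E +
  fixes x\<^sub>0 :: 'a
  assumes root_in_V: "x\<^sub>0 \<in> V"
    and valence_const:
      "x \<in> sphere_at V E x\<^sub>0 r \<Longrightarrow> y \<in> sphere_at V E x\<^sub>0 r \<Longrightarrow> valence E x = valence E y"

text \<open>
  In a model tree no sphere is empty, so this determines \<open>n\<close>; and a vertex other than the root has
  positive valence, so the subtraction is not truncated.
\<close>

definition branching_function ::
    "'a set \<Rightarrow> ('a \<Rightarrow> 'a \<Rightarrow> bool) \<Rightarrow> 'a \<Rightarrow> (nat \<Rightarrow> nat) \<Rightarrow> bool"
  where "branching_function V E x\<^sub>0 n \<longleftrightarrow>
    n 0 = valence E x\<^sub>0 \<and> (\<forall>r>0. \<forall>x \<in> sphere_at V E x\<^sub>0 r. n r = valence E x - 1)"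

definition laplacian :: "('a \<Rightarrow> 'a \<Rightarrow> bool) \<Rightarrow> ('a \<Rightarrow> real) \<Rightarrow> 'a \<Rightarrow> real"
  where "laplacian E f x = (\<Sum>y | E x y. f x - f y)"

text \<open>
  Infinite differentiability on \<open>[0, \<infinity>)\<close>, with one-sided derivatives at \<open>0\<close>: \<open>D k\<close> is the
  \<open>k\<close>-th derivative of \<open>f\<close>.
\<close>

definition smooth_on_nonneg :: "(real \<Rightarrow> real) \<Rightarrow> bool"
  where "smooth_on_nonneg f \<longleftrightarrow>
    (\<exists>D :: nat \<Rightarrow> real \<Rightarrow> real. (\<forall>t\<ge>0. D 0 t = f t) \<and>
      (\<forall>k. \<forall>t\<ge>0. (D k has_real_derivative D (Suc k) t) (at t within {0..})))"

text \<open>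
  A function on \<open>V \<times> V \<times> [0, \<infinity>)\<close> is represented by its extension by \<open>0\<close>. The pointwise order of
  such functions is then the order of the function type, so that \<open>LEAST\<close> below denotes the
  pointwise smallest one.
\<close>

definition nonneg_fundamental_solution ::
    "'a set \<Rightarrow> ('a \<Rightarrow> 'a \<Rightarrow> bool) \<Rightarrow> (real \<Rightarrow> 'a \<Rightarrow> 'a \<Rightarrow> real) \<Rightarrow> bool"
  where "nonneg_fundamental_solution V E p \<longleftrightarrow>
    (\<forall>t x y. \<not> (0 \<le> t \<and> x \<in> V \<and> y \<in> V) \<longrightarrow> p t x y = 0) \<and>
    (\<forall>x\<in>V. \<forall>y\<in>V.
      (\<forall>t\<ge>0. 0 \<le> p t x y) \<and>
      smooth_on_nonneg (\<lambda>t. p t x y) \<and>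
      (\<forall>t\<ge>0. \<exists>p'. ((\<lambda>s. p s x y) has_real_derivative p') (at t within {0..}) \<and>
        laplacian E (\<lambda>z. p t z y) x + p' = 0 \<and>
        laplacian E (\<lambda>z. p t x z) y + p' = 0) \<and>
      p 0 x y = (if x = y then 1 else 0))"

definition heat_kernel :: "'a set \<Rightarrow> ('a \<Rightarrow> 'a \<Rightarrow> bool) \<Rightarrow> real \<Rightarrow> 'a \<Rightarrow> 'a \<Rightarrow> real"
  where "heat_kernel V E = (LEAST p. nonneg_fundamental_solution V E p)"

text \<open>The sum is taken in \<^typ>\<open>ennreal\<close> because a divergent real \<open>infsum\<close> would be \<open>0\<close>.\<close>

definition stochastically_incomplete :: "'a set \<Rightarrow> ('a \<Rightarrow> 'a \<Rightarrow> bool) \<Rightarrow> bool"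
  where "stochastically_incomplete V E \<longleftrightarrow>
    (\<exists>x\<in>V. \<exists>t>0. (\<Sum>\<^sub>\<infinity>y\<in>V. ennreal (heat_kernel V E t x y)) < 1)"

definition stochastically_complete :: "'a set \<Rightarrow> ('a \<Rightarrow> 'a \<Rightarrow> bool) \<Rightarrow> bool"
  where "stochastically_complete V E \<longleftrightarrow> \<not> stochastically_incomplete V E"

end

theory Submission
  imports Defs
begin

text \<open>
  The heat kernel of any infinite graph is the supremum, over finite vertex sets \<open>F\<close>, of the heat
  kernels with Dirichlet condition outside \<open>F\<close>, which are matrix exponentials; the minimum principle
  on \<open>F\<close> shows that they increase with \<open>F\<close> and lie below every nonnegative fundamental solution.
  It also compares their total mass with other functions: the mass tends to \<open>1\<close> if there is a proper
  \<open>v \<ge> 0\<close> with \<open>-\<Delta>v \<le> \<lambda>v\<close>, and drops below \<open>1\<close> if there is a bounded \<open>v\<close> with \<open>-\<Delta>v \<ge> c > 0\<close>. On a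
  model tree the radial functions \<open>v(r) = 1 + \<Sum>\<^sub>i\<^sub><\<^sub>r 1/n(i)\<close> and \<open>w(r) = \<Sum>\<^sub>i\<^sub><\<^sub>r v(i)/n(i)\<close> serve these
  two purposes when the series diverges and converges, respectively.
\<close>

section \<open>Calculus\<close>

text \<open>A Lipschitz constant common to all \<open>k\<close> bounds the first-order Taylor
  remainder at \<open>t\<close> quadratically, and such a bound survives pointwise limits.\<close>

lemma has_real_derivative_pointwise_limit:
  fixes f f' :: "'i \<Rightarrow> real \<Rightarrow> real"
  assumes F: "F \<noteq> bot" and S: "convex S" "t \<in> S"
    and deriv: "\<forall>\<^sub>F k in F. \<forall>s\<in>S. (f k has_real_derivative f' k s) (at s within S)"
    and lips: "\<forall>\<^sub>F k in F. \<forall>s\<in>S. \<bar>f' k s - f' k t\<bar> \<le> C * \<bar>s - t\<bar>"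
    and lim: "\<And>s. s \<in> S \<Longrightarrow> ((\<lambda>k. f k s) \<longlongrightarrow> g s) F"
    and lim': "((\<lambda>k. f' k t) \<longlongrightarrow> g') F"
  shows "(g has_real_derivative g') (at t within S)"
proof -
  have quad: "\<bar>g s - g t - (s - t) * g'\<bar> \<le> C * \<bar>s - t\<bar> * \<bar>s - t\<bar>" if s: "s \<in> S" for s
  proof (rule tendsto_upperbound[OF _ _ F])
    show "((\<lambda>k. \<bar>f k s - f k t - (s - t) * f' k t\<bar>) \<longlongrightarrow> \<bar>g s - g t - (s - t) * g'\<bar>) F"
      by (intro tendsto_intros lim lim' s S)
    show "\<forall>\<^sub>F k in F. \<bar>f k s - f k t - (s - t) * f' k t\<bar> \<le> C * \<bar>s - t\<bar> * \<bar>s - t\<bar>"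
      using deriv lips
    proof eventually_elim
      case (elim k)
      let ?I = "closed_segment s t"
      have sub: "?I \<subseteq> S" using S s by (simp add: closed_segment_subset)
      \<comment> \<open>The sign of \<open>C\<close> is not assumed; away from \<open>t\<close> the
        Lipschitz bound itself forces it.\<close>
      have C0: "C \<ge> 0 \<or> s = t"
      proof (rule ccontr)
        assume "\<not> ?thesis"
        then have "C * \<bar>s - t\<bar> < 0" by (simp add: mult_less_0_iff)
        moreover have "\<bar>f' k s - f' k t\<bar> \<le> C * \<bar>s - t\<bar>" using elim s by blast
        ultimately show False by linarith
      qed
      \<comment> \<open>Mean value inequality for \<open>f k s - s * f' k t\<close>, whose
        derivative vanishes at \<open>t\<close> and is small nearby.\<close>
      have "norm ((f k s - s * f' k t) - (f k t - t * f' k t)) \<le> (C * \<bar>s - t\<bar>) * norm (s - t)"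
      proof (rule field_differentiable_bound[where S = ?I and f' = "\<lambda>r. f' k r - f' k t"])
        fix r assume r: "r \<in> ?I"
        have "((\<lambda>s. f k s - s * f' k t) has_real_derivative f' k r - 1 * f' k t) (at r within S)"
          using elim r sub by (intro DERIV_diff DERIV_cmult_right DERIV_ident) auto
        then show "((\<lambda>s. f k s - s * f' k t) has_real_derivative f' k r - f' k t) (at r within ?I)"
          using sub by (auto intro: DERIV_subset)
        have "\<bar>f' k r - f' k t\<bar> \<le> C * \<bar>r - t\<bar>" using elim r sub by blast
        also have "\<dots> \<le> C * \<bar>s - t\<bar>"
        proof -
          have "\<bar>r - t\<bar> \<le> \<bar>s - t\<bar>" using r by (auto simp: closed_segment_eq_real_ivl split: if_splits)
          then show ?thesis using C0 by (auto intro: mult_left_mono)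
        qed
        finally show "norm (f' k r - f' k t) \<le> C * \<bar>s - t\<bar>" by simp
      qed auto
      then show ?case by (simp add: algebra_simps)
    qed
  qed
  show ?thesis
    unfolding has_field_derivative_iff
  proof (rule Lim_null[THEN iffD2], rule Lim_null_comparison)
    show "\<forall>\<^sub>F s in at t within S. norm ((g s - g t) / (s - t) - g') \<le> C * \<bar>s - t\<bar>"
      unfolding eventually_at_filter
    proof (rule always_eventually, intro allI impI)
      fix s assume s: "s \<noteq> t" "s \<in> S"
      then have "norm ((g s - g t) / (s - t) - g') = \<bar>g s - g t - (s - t) * g'\<bar> / \<bar>s - t\<bar>"
        by (simp add: field_simps flip: abs_divide)
      also have "\<dots> \<le> C * \<bar>s - t\<bar>"
        using quad[of s] s by (simp add: divide_le_eq)
      finally show "norm ((g s - g t) / (s - t) - g') \<le> C * \<bar>s - t\<bar>" .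
    qed
    have "((\<lambda>s. C * \<bar>s - t\<bar>) \<longlongrightarrow> C * \<bar>t - t\<bar>) (at t within S)"
      by (intro tendsto_intros)
    then show "((\<lambda>s. C * \<bar>s - t\<bar>) \<longlongrightarrow> 0) (at t within S)" by simp
  qed
qed

section \<open>The minimum principle\<close>

context infinite_graph
begin

lemma laplacian_diff: "laplacian E (\<lambda>x. f x - g x) x = laplacian E f x - laplacian E g x"
  by (simp add: laplacian_def sum_subtractf[symmetric] algebra_simps)

lemma laplacian_cmult: "laplacian E (\<lambda>x. c * f x) x = c * laplacian E f x"
  by (simp add: laplacian_def sum_distrib_left algebra_simps)

lemma laplacian_const: "laplacian E (\<lambda>x. c) x = 0"
  by (simp add: laplacian_def)

lemma laplacian_sum: "laplacian E (\<lambda>x. \<Sum>i\<in>I. f i x) x = (\<Sum>i\<in>I. laplacian E (f i) x)"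
  unfolding laplacian_def sum_subtractf[symmetric] by (rule sum.swap)

lemma has_real_derivative_laplacian:
  assumes x: "x \<in> V" and u: "\<And>z. z \<in> V \<Longrightarrow> ((\<lambda>s. u s z) has_real_derivative u' z) (at t within S)"
  shows "((\<lambda>s. laplacian E (u s) x) has_real_derivative laplacian E u' x) (at t within S)"
  unfolding laplacian_def
  by (intro derivative_intros u x) (use adj_in_V in auto)

text \<open>At a negative minimum over \<open>F\<close> and \<open>{0..T}\<close> the Laplacian is
  at most \<open>0\<close>, so the time derivative is nonnegative. A small term linear in time makes
  it positive, and then an earlier value is smaller still.\<close>

lemma minimum_principle:
  assumes F: "finite F" "F \<subseteq> V"
    and deriv: "\<And>x t. x \<in> F \<Longrightarrow> t \<in> {0..T} \<Longrightarrow>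
      ((\<lambda>s. u s x) has_real_derivative u' t x) (at t within {0..T})"
    and super: "\<And>x t. x \<in> F \<Longrightarrow> t \<in> {0..T} \<Longrightarrow> 0 \<le> u' t x + laplacian E (u t) x"
    and outside: "\<And>x t. x \<in> V - F \<Longrightarrow> t \<in> {0..T} \<Longrightarrow> 0 \<le> u t x"
    and init: "\<And>x. x \<in> F \<Longrightarrow> 0 \<le> u 0 x"
    and x: "x \<in> V" and t: "t \<in> {0..T}"
  shows "0 \<le> u t x"
proof (rule ccontr)
  assume "\<not> 0 \<le> u t x"
  then have neg: "u t x < 0" by simp
  have T: "0 \<le> T" using t by auto
  have xF: "x \<in> F" using outside[OF _ t, of x] neg x by force
  \<comment> \<open>Chosen so that the perturbation raises the value at \<open>t\<close>,
    \<open>x\<close> only by half of its modulus, which leaves \<open>w t x\<close>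
    negative.\<close>
  define \<epsilon> where "\<epsilon> = - u t x / (2 * (1 + t))"
  have \<epsilon>: "\<epsilon> > 0" using neg t unfolding \<epsilon>_def by (intro divide_pos_pos) auto
  define w where "w s z = u s z + \<epsilon> * (1 + s)" for s z
  have "\<epsilon> * (1 + t) = - u t x / 2" using t by (simp add: \<epsilon>_def field_simps)
  then have wneg: "w t x < 0" using neg by (simp add: w_def)
  have dw: "((\<lambda>s. w s z) has_real_derivative u' s z + \<epsilon>) (at s within {0..T})"
    if "z \<in> F" "s \<in> {0..T}" for z s
    unfolding w_def by (rule derivative_eq_intros deriv that refl | simp)+
  \<comment> \<open>Minimise in time at each vertex first, then over the finite set
    \<open>F\<close>.\<close>
  have "\<exists>s\<in>{0..T}. \<forall>s'\<in>{0..T}. w s z \<le> w s' z" if z: "z \<in> F" for z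
  proof (rule continuous_attains_inf)
    show "continuous_on {0..T} (\<lambda>s. w s z)"
      using dw[OF z] by (rule DERIV_continuous_on)
  qed (use T in auto)
  then obtain \<tau> where \<tau>: "\<And>z. z \<in> F \<Longrightarrow> \<tau> z \<in> {0..T}"
      "\<And>z s. z \<in> F \<Longrightarrow> s \<in> {0..T} \<Longrightarrow> w (\<tau> z) z \<le> w s z" by metis
  obtain y where y: "y \<in> F" "\<And>z. z \<in> F \<Longrightarrow> w (\<tau> y) y \<le> w (\<tau> z) z"
    using ex_min_if_finite[of "(\<lambda>z. w (\<tau> z) z) ` F"] F xF by (auto simp: not_less)
  define s where "s = \<tau> y"
  have s: "s \<in> {0..T}" using \<tau> y by (simp add: s_def)
  have minF: "w s y \<le> w s' z" if "z \<in> F" "s' \<in> {0..T}" for z s'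
    using y(2)[OF that(1)] \<tau>(2)[OF that] by (simp add: s_def)
  have wy: "w s y < 0" using minF[OF xF t] wneg by linarith
  have s0: "s > 0"
  proof (rule ccontr)
    assume "\<not> s > 0"
    then have "s = 0" using s by auto
    then show False using wy init[OF y(1)] \<epsilon> by (simp add: w_def)
  qed
  \<comment> \<open>Off \<open>F\<close> the function \<open>w\<close> is nonnegative, so the
    minimum over \<open>F\<close> is also one against neighbours outside \<open>F\<close>.\<close>
  have "w s y \<le> w s z" if "z \<in> V" for z
  proof (cases "z \<in> F")
    case True
    then show ?thesis using minF s by blast
  next
    case False
    have "0 \<le> w s z" using outside[of z s] False that s \<epsilon> by (auto simp: w_def)
    then show ?thesis using wy by linarith
  qed
  then have "laplacian E (u s) y \<le> 0"
    unfolding laplacian_def using adj_in_V by (intro sum_nonpos) (force simp: w_def)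
  then have pos: "u' s y + \<epsilon> > 0" using super[OF y(1) s] \<epsilon> by linarith
  obtain d where d: "d > 0" "\<And>h. h > 0 \<Longrightarrow> s - h \<in> {0..T} \<Longrightarrow> h < d \<Longrightarrow> w (s - h) y < w s y"
    using has_real_derivative_pos_inc_left[OF dw[OF y(1) s] pos] by blast
  define h where "h = min s d / 2"
  have "h > 0" "h < d" "s - h \<in> {0..T}" using d(1) s0 s by (auto simp: h_def min_def)
  then show False using d(2)[of h] minF[OF y(1), of "s - h"] by auto
qed


section \<open>Heat kernels of finite vertex sets with Dirichlet boundary condition\<close>

text \<open>A sum rather than a maximum of the valences, so that the empty set needs no special
  case.\<close>

definition dirichlet_shift :: "'a set \<Rightarrow> real"
  where "dirichlet_shift F = (\<Sum>x\<in>F. real (valence E x))"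

text \<open>The shift times the identity, minus the Laplacian on functions vanishing off
  \<open>F\<close>. The valence on the diagonal also counts edges leaving \<open>F\<close>; this is
  the Dirichlet condition.\<close>

definition dirichlet_matrix :: "'a set \<Rightarrow> 'a \<Rightarrow> 'a \<Rightarrow> real"
  where "dirichlet_matrix F x y =
    (if x \<in> F \<and> y \<in> F
     then (if x = y then dirichlet_shift F - real (valence E x) else if E x y then 1 else 0)
     else 0)"

text \<open>Matrix powers over the index set \<open>F\<close>. Even the zeroth one vanishes off
  \<open>F\<close>, and hence so does the kernel.\<close>

fun dirichlet_power :: "'a set \<Rightarrow> nat \<Rightarrow> 'a \<Rightarrow> 'a \<Rightarrow> real" where
  "dirichlet_power F 0 x y = (if x = y \<and> x \<in> F then 1 else 0)"
| "dirichlet_power F (Suc j) x y = (\<Sum>z\<in>F. dirichlet_matrix F x z * dirichlet_power F j z y)"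

text \<open>
  The shift makes the entries of the matrix nonnegative, so that all terms of the exponential series
  are nonnegative; the factor in front undoes it.
\<close>

definition dirichlet_kernel :: "'a set \<Rightarrow> real \<Rightarrow> 'a \<Rightarrow> 'a \<Rightarrow> real"
  where "dirichlet_kernel F t x y =
    exp (- dirichlet_shift F * t) * (\<Sum>j. dirichlet_power F j x y / fact j * t ^ j)"

section \<open>Powers of the Dirichlet matrix, their exponential series and its comparison with
  supersolutions\<close>

context
  fixes F :: "'a set"
  assumes finF: "finite F" and FV: "F \<subseteq> V"
begin

lemma valence_le_dirichlet_shift: "x \<in> F \<Longrightarrow> real (valence E x) \<le> dirichlet_shift F"
  unfolding dirichlet_shift_def using finF by (intro member_le_sum) auto

lemma dirichlet_matrix_nonneg: "0 \<le> dirichlet_matrix F x y"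
  using valence_le_dirichlet_shift[of x] by (auto simp: dirichlet_matrix_def)

lemma dirichlet_matrix_sym: "dirichlet_matrix F x y = dirichlet_matrix F y x"
  using adj_sym by (auto simp: dirichlet_matrix_def)

text \<open>As \<open>f\<close> vanishes off \<open>F\<close>, the sum over \<open>F - {x}\<close>
  is the sum of \<open>f\<close> over all neighbours of \<open>x\<close>.\<close>

lemma dirichlet_matrix_mult:
  assumes x: "x \<in> F" and f: "\<And>z. z \<notin> F \<Longrightarrow> f z = 0"
  shows "(\<Sum>z\<in>F. dirichlet_matrix F x z * f z) = dirichlet_shift F * f x - laplacian E f x"
proof -
  have fin: "finite {z. E x z}" using x FV locally_finite by auto
  have "(\<Sum>z\<in>F - {x}. dirichlet_matrix F x z * f z) = (\<Sum>z | E x z. f z)"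
  proof (rule sum.mono_neutral_cong[OF fin])
    show "finite (F - {x})" using finF by simp
  qed (use x f adj_irrefl in \<open>auto simp: dirichlet_matrix_def\<close>)
  moreover have "laplacian E f x = real (valence E x) * f x - (\<Sum>z | E x z. f z)"
    by (simp add: laplacian_def sum_subtractf valence_def)
  moreover have "(\<Sum>z\<in>F. dirichlet_matrix F x z * f z) =
      dirichlet_matrix F x x * f x + (\<Sum>z\<in>F - {x}. dirichlet_matrix F x z * f z)"
    using sum.remove[OF finF x] by fastforce
  ultimately show ?thesis using x by (simp add: dirichlet_matrix_def algebra_simps)
qed

lemma dirichlet_power_nonneg: "0 \<le> dirichlet_power F j x y"
  by (induction j arbitrary: x) (auto intro!: sum_nonneg mult_nonneg_nonneg dirichlet_matrix_nonneg)

lemma dirichlet_power_outside: "x \<notin> F \<or> y \<notin> F \<Longrightarrow> dirichlet_power F j x y = 0"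
proof (induction j arbitrary: x)
  case (Suc j)
  show ?case
  proof (cases "x \<in> F")
    case True
    then show ?thesis using Suc by simp
  next
    case False
    then show ?thesis by (simp add: dirichlet_matrix_def)
  qed
qed auto

text \<open>The recursion multiplies from the left; having it from the right too, the symmetry of
  the matrix passes to its powers.\<close>

lemma dirichlet_power_Suc_right:
  "dirichlet_power F (Suc j) x y = (\<Sum>z\<in>F. dirichlet_power F j x z * dirichlet_matrix F z y)"
proof (induction j arbitrary: x)
  case 0
  have "dirichlet_power F (Suc 0) x y = (\<Sum>z\<in>F. if y = z then dirichlet_matrix F x z else 0)"
    unfolding dirichlet_power.simps by (rule sum.cong) auto
  also have "\<dots> = (if y \<in> F then dirichlet_matrix F x y else 0)"
    by (rule sum.delta'[OF finF])
  also have "\<dots> = (if x \<in> F then dirichlet_matrix F x y else 0)"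
    by (simp add: dirichlet_matrix_def)
  also have "\<dots> = (\<Sum>z\<in>F. if x = z then dirichlet_matrix F z y else 0)"
    by (rule sum.delta'[OF finF, symmetric])
  also have "\<dots> = (\<Sum>z\<in>F. dirichlet_power F 0 x z * dirichlet_matrix F z y)"
    unfolding dirichlet_power.simps by (rule sum.cong) auto
  finally show ?case .
next
  case (Suc j)
  have "dirichlet_power F (Suc (Suc j)) x y =
      (\<Sum>z\<in>F. dirichlet_matrix F x z * dirichlet_power F (Suc j) z y)"
    by (rule dirichlet_power.simps)
  also have "\<dots> = (\<Sum>z\<in>F. dirichlet_matrix F x z *
      (\<Sum>w\<in>F. dirichlet_power F j z w * dirichlet_matrix F w y))"
    using Suc.IH by simp
  also have "\<dots> = (\<Sum>z\<in>F. \<Sum>w\<in>F. dirichlet_matrix F x z *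
      dirichlet_power F j z w * dirichlet_matrix F w y)"
    by (simp add: sum_distrib_left mult.assoc)
  also have "\<dots> = (\<Sum>w\<in>F. \<Sum>z\<in>F. dirichlet_matrix F x z *
      dirichlet_power F j z w * dirichlet_matrix F w y)"
    by (rule sum.swap)
  also have "\<dots> = (\<Sum>w\<in>F. dirichlet_power F (Suc j) x w * dirichlet_matrix F w y)"
    by (simp add: sum_distrib_right)
  finally show ?case .
qed

lemma dirichlet_power_sym: "dirichlet_power F j x y = dirichlet_power F j y x"
proof (induction j arbitrary: x y)
  case (Suc j)
  have "dirichlet_power F (Suc j) x y = (\<Sum>z\<in>F. dirichlet_power F j y z * dirichlet_matrix F z x)"
    using Suc dirichlet_matrix_sym by (simp add: mult.commute)
  then show ?case using dirichlet_power_Suc_right by metis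
qed auto

text \<open>The sum of all entries dominates every row sum. This crude geometric growth suffices for
  the exponential series to converge.\<close>

lemma dirichlet_power_le:
  "dirichlet_power F j x y \<le> (\<Sum>x\<in>F. \<Sum>z\<in>F. dirichlet_matrix F x z) ^ j"
proof (induction j arbitrary: x)
  case (Suc j)
  let ?M = "\<Sum>x\<in>F. \<Sum>z\<in>F. dirichlet_matrix F x z"
  have M: "0 \<le> ?M" by (intro sum_nonneg dirichlet_matrix_nonneg)
  have "dirichlet_power F (Suc j) x y \<le> (\<Sum>z\<in>F. dirichlet_matrix F x z * ?M ^ j)"
    using Suc by (auto intro!: sum_mono mult_left_mono dirichlet_matrix_nonneg)
  also have "\<dots> = (\<Sum>z\<in>F. dirichlet_matrix F x z) * ?M ^ j"
    by (simp add: sum_distrib_right)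
  also have "\<dots> \<le> ?M * ?M ^ j"
  proof (rule mult_right_mono)
    show "(\<Sum>z\<in>F. dirichlet_matrix F x z) \<le> ?M"
    proof (cases "x \<in> F")
      case True
      then show ?thesis
        using finF by (intro member_le_sum[of x F "\<lambda>x. \<Sum>z\<in>F. dirichlet_matrix F x z"])
          (auto intro!: sum_nonneg dirichlet_matrix_nonneg)
    next
      case False
      then have "(\<Sum>z\<in>F. dirichlet_matrix F x z) = 0" by (simp add: dirichlet_matrix_def)
      then show ?thesis using M by simp
    qed
  qed (use M in simp)
  finally show ?case by simp
qed auto

lemma dirichlet_summable: "summable (\<lambda>j. dirichlet_power F j x y / fact j * t ^ j)"
proof -
  let ?M = "\<Sum>x\<in>F. \<Sum>z\<in>F. dirichlet_matrix F x z"
  show ?thesis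
  proof (rule summable_comparison_test'[OF summable_exp])
    show "norm (dirichlet_power F j x y / fact j * t ^ j) \<le> inverse (fact j) * (?M * \<bar>t\<bar>) ^ j" for j
      using dirichlet_power_le[of j x y] dirichlet_power_nonneg[of j x y]
      by (auto simp: abs_mult power_abs power_mult_distrib field_simps intro: mult_left_mono)
  qed
qed

lemma dirichlet_kernel_nonneg: "0 \<le> t \<Longrightarrow> 0 \<le> dirichlet_kernel F t x y"
  unfolding dirichlet_kernel_def
  by (intro mult_nonneg_nonneg suminf_nonneg dirichlet_summable) (auto simp: dirichlet_power_nonneg)

lemma dirichlet_kernel_outside: "x \<notin> F \<or> y \<notin> F \<Longrightarrow> dirichlet_kernel F t x y = 0"
  unfolding dirichlet_kernel_def by (subst dirichlet_power_outside) auto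

lemma dirichlet_kernel_sym: "dirichlet_kernel F t x y = dirichlet_kernel F t y x"
  unfolding dirichlet_kernel_def using dirichlet_power_sym by simp

lemma dirichlet_kernel_0: "x \<in> F \<Longrightarrow> dirichlet_kernel F 0 x y = (if x = y then 1 else 0)"
  unfolding dirichlet_kernel_def powser_zero by simp

text \<open>Termwise differentiation produces one more matrix factor, that is the shift minus the
  Laplacian; differentiating the exponential prefactor cancels the shift.\<close>

lemma dirichlet_kernel_deriv:
  assumes x: "x \<in> F"
  shows "((\<lambda>s. dirichlet_kernel F s x y) has_real_derivative
    - laplacian E (\<lambda>z. dirichlet_kernel F t z y) x) (at t within S)"
proof -
  define g where "g t x = (\<Sum>j. dirichlet_power F j x y / fact j * t ^ j)" for t x
  have "((\<lambda>s. g s x) has_real_derivative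
      (\<Sum>j. diffs (\<lambda>j. dirichlet_power F j x y / fact j) j * t ^ j)) (at t)"
    unfolding g_def by (rule termdiffs_strong_converges_everywhere) (rule dirichlet_summable)
  \<comment> \<open>The factor \<open>Suc j\<close> from \<open>diffs\<close> cancels in
    \<open>fact (Suc j)\<close>, and the recursion for the powers splits off one matrix
    factor.\<close>
  also have "(\<lambda>j. diffs (\<lambda>j. dirichlet_power F j x y / fact j) j * t ^ j) =
      (\<lambda>j. \<Sum>z\<in>F. dirichlet_matrix F x z * (dirichlet_power F j z y / fact j * t ^ j))"
    by (rule ext) (simp add: diffs_def sum_distrib_right sum_distrib_left sum_divide_distrib field_simps
        del: of_nat_Suc)
  also have "(\<Sum>j. \<Sum>z\<in>F. dirichlet_matrix F x z * (dirichlet_power F j z y / fact j * t ^ j)) =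
      (\<Sum>z\<in>F. dirichlet_matrix F x z * g t z)"
    unfolding g_def
    by (simp add: suminf_sum suminf_mult summable_mult dirichlet_summable del: times_divide_eq_left)
  also have "\<dots> = dirichlet_shift F * g t x - laplacian E (g t) x"
    using x by (intro dirichlet_matrix_mult) (simp_all add: g_def dirichlet_power_outside)
  finally have "((\<lambda>s. g s x) has_real_derivative \<dots>) (at t)" .
  then have "((\<lambda>s. exp (- dirichlet_shift F * s) * g s x) has_real_derivative
      - (exp (- dirichlet_shift F * t) * laplacian E (g t) x)) (at t)"
    by (auto intro!: derivative_eq_intros simp: algebra_simps)
  then have "((\<lambda>s. dirichlet_kernel F s x y) has_real_derivative
      - laplacian E (\<lambda>z. dirichlet_kernel F t z y) x) (at t)"
    unfolding dirichlet_kernel_def g_def by (simp add: laplacian_cmult)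
  then show ?thesis by (rule has_field_derivative_at_within)
qed

text \<open>Minimum principle for the difference, since the kernel vanishes off \<open>F\<close>.
  Summing over \<open>G\<close> covers both single entries, with \<open>G = {y}\<close>, and the
  mass.\<close>

lemma dirichlet_kernel_le_supersolution:
  assumes deriv: "\<And>x t. x \<in> F \<Longrightarrow> t \<in> {0..T} \<Longrightarrow>
      ((\<lambda>s. u s x) has_real_derivative u' t x) (at t within {0..T})"
    and super: "\<And>x t. x \<in> F \<Longrightarrow> t \<in> {0..T} \<Longrightarrow> 0 \<le> u' t x + laplacian E (u t) x"
    and nonneg: "\<And>x t. x \<in> V \<Longrightarrow> t \<in> {0..T} \<Longrightarrow> 0 \<le> u t x"
    and init: "\<And>x. x \<in> F \<Longrightarrow> (\<Sum>y\<in>G. if x = y then 1 else 0) \<le> u 0 x"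
    and x: "x \<in> V" and t: "t \<in> {0..T}"
  shows "(\<Sum>y\<in>G. dirichlet_kernel F t x y) \<le> u t x"
proof -
  have "0 \<le> u t x - (\<Sum>y\<in>G. dirichlet_kernel F t x y)"
  proof (rule minimum_principle[OF finF FV _ _ _ _ x t, where u' =
        "\<lambda>t x. u' t x - (\<Sum>y\<in>G. - laplacian E (\<lambda>z. dirichlet_kernel F t z y) x)"])
    fix x t assume x: "x \<in> F" and t: "t \<in> {0..T}"
    show "((\<lambda>s. u s x - (\<Sum>y\<in>G. dirichlet_kernel F s x y)) has_real_derivative
        u' t x - (\<Sum>y\<in>G. - laplacian E (\<lambda>z. dirichlet_kernel F t z y) x)) (at t within {0..T})"
      by (intro DERIV_diff DERIV_sum deriv dirichlet_kernel_deriv x t)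
    show "0 \<le> u' t x - (\<Sum>y\<in>G. - laplacian E (\<lambda>z. dirichlet_kernel F t z y) x) +
        laplacian E (\<lambda>x. u t x - (\<Sum>y\<in>G. dirichlet_kernel F t x y)) x"
      using super[OF x t] by (simp add: laplacian_diff laplacian_sum sum_negf)
  next
    fix x t assume "x \<in> V - F" "t \<in> {0..T}"
    then show "0 \<le> u t x - (\<Sum>y\<in>G. dirichlet_kernel F t x y)"
      using nonneg by (simp add: dirichlet_kernel_outside)
  next
    fix x assume "x \<in> F"
    then show "0 \<le> u 0 x - (\<Sum>y\<in>G. dirichlet_kernel F 0 x y)"
      using init by (simp add: dirichlet_kernel_0)
  qed
  then show ?thesis by simp
qed

lemma dirichlet_kernel_sum_le_1:
  assumes "x \<in> V" "0 \<le> t" "finite G"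
  shows "(\<Sum>y\<in>G. dirichlet_kernel F t x y) \<le> 1"
  by (rule dirichlet_kernel_le_supersolution[where T = t and u' = "\<lambda>t x. 0" and u = "\<lambda>t x. 1"])
    (use assms in \<open>auto simp: laplacian_const sum.delta'\<close>)

lemma dirichlet_kernel_le_1: "x \<in> V \<Longrightarrow> 0 \<le> t \<Longrightarrow> dirichlet_kernel F t x y \<le> 1"
  using dirichlet_kernel_sum_le_1[of x t "{y}"] by simp

text \<open>The Laplacian at \<open>x\<close> is a sum of \<open>valence E x\<close> differences of
  numbers between \<open>0\<close> and \<open>1\<close>. The constant does not depend on
  \<open>F\<close>, as the limit over \<open>F\<close> requires.\<close>

lemma dirichlet_kernel_lipschitz:
  fixes s t :: real
  assumes x: "x \<in> V" and st: "0 \<le> s" "0 \<le> t"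
  shows "\<bar>dirichlet_kernel F s x y - dirichlet_kernel F t x y\<bar> \<le> valence E x * \<bar>s - t\<bar>"
proof (cases "x \<in> F")
  case True
  have "norm (dirichlet_kernel F s x y - dirichlet_kernel F t x y) \<le> valence E x * norm (s - t)"
  proof (rule field_differentiable_bound[where S = "{0..}"])
    fix r :: real assume r: "r \<in> {0..}"
    show "((\<lambda>s. dirichlet_kernel F s x y) has_real_derivative
        - laplacian E (\<lambda>z. dirichlet_kernel F r z y) x) (at r within {0..})"
      by (rule dirichlet_kernel_deriv[OF True])
    have "\<bar>laplacian E (\<lambda>z. dirichlet_kernel F r z y) x\<bar> \<le>
        (\<Sum>z | E x z. \<bar>dirichlet_kernel F r x y - dirichlet_kernel F r z y\<bar>)"
      unfolding laplacian_def by (rule sum_abs)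
    also have "\<dots> \<le> (\<Sum>z | E x z. 1)"
    proof (rule sum_mono)
      fix z assume "z \<in> {z. E x z}"
      then have "z \<in> V" using adj_in_V by auto
      then show "\<bar>dirichlet_kernel F r x y - dirichlet_kernel F r z y\<bar> \<le> 1"
        using dirichlet_kernel_le_1[of z r y] dirichlet_kernel_le_1[of x r y] x r
          dirichlet_kernel_nonneg[of r z y] dirichlet_kernel_nonneg[of r x y] by simp
    qed
    finally show "norm (- laplacian E (\<lambda>z. dirichlet_kernel F r z y) x) \<le> valence E x"
      by (simp add: valence_def)
  qed (use st in auto)
  then show ?thesis by simp
next
  case False
  then show ?thesis by (simp add: dirichlet_kernel_outside)
qed

end

text \<open>On the smaller set the kernel of \<open>G\<close> solves the heat equation with the same
  initial values, and outside it is still nonnegative.\<close>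

lemma dirichlet_kernel_mono:
  assumes "finite G" "F \<subseteq> G" "G \<subseteq> V" "x \<in> V" "0 \<le> t"
  shows "dirichlet_kernel F t x y \<le> dirichlet_kernel G t x y"
proof -
  have F: "finite F" "F \<subseteq> V" using assms by (auto intro: finite_subset)
  have "(\<Sum>y\<in>{y}. dirichlet_kernel F t x y) \<le> dirichlet_kernel G t x y"
  proof (rule dirichlet_kernel_le_supersolution[OF F, where T = t and u = "\<lambda>t x. dirichlet_kernel G t x y"])
    show "((\<lambda>s. dirichlet_kernel G s x y) has_real_derivative
        - laplacian E (\<lambda>z. dirichlet_kernel G s z y) x) (at s within {0..t})" if "x \<in> F" for x s
      using assms that by (intro dirichlet_kernel_deriv) auto
    show "(\<Sum>y\<in>{y}. if x = y then 1 else 0) \<le> dirichlet_kernel G 0 x y" if "x \<in> F" for x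
      using assms that by (subst dirichlet_kernel_0) auto
  qed (use assms in \<open>simp_all add: dirichlet_kernel_nonneg\<close>)
  then show ?thesis by simp
qed

text \<open>A nonnegative fundamental solution is a supersolution on every finite set; this yields
  the minimality of the supremum.\<close>

lemma dirichlet_kernel_le_fundamental_solution:
  assumes q: "nonneg_fundamental_solution V E q" and F: "finite F" "F \<subseteq> V"
    and x: "x \<in> V" and y: "y \<in> V" and t: "0 \<le> t"
  shows "dirichlet_kernel F t x y \<le> q t x y"
proof -
  have "(\<Sum>y\<in>{y}. dirichlet_kernel F t x y) \<le> q t x y"
  proof (rule dirichlet_kernel_le_supersolution[OF F, where T = t and u = "\<lambda>t x. q t x y"])
    fix x s assume x: "x \<in> F" and s: "s \<in> {0..t}"
    then have "x \<in> V" "0 \<le> s" using F by auto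
    then have "\<exists>q'. ((\<lambda>s. q s x y) has_real_derivative q') (at s within {0..}) \<and>
        laplacian E (\<lambda>z. q s z y) x + q' = 0"
      using q y unfolding nonneg_fundamental_solution_def by meson
    then obtain q' where q': "((\<lambda>s. q s x y) has_real_derivative q') (at s within {0..})"
      "laplacian E (\<lambda>z. q s z y) x + q' = 0" by blast
    then have "q' = - laplacian E (\<lambda>z. q s z y) x" by simp
    with q'(1) have "((\<lambda>s. q s x y) has_real_derivative - laplacian E (\<lambda>z. q s z y) x)
        (at s within {0..})" by simp
    then show "((\<lambda>s. q s x y) has_real_derivative - laplacian E (\<lambda>z. q s z y) x) (at s within {0..t})"
      by (rule DERIV_subset) auto
  next
    show "0 \<le> q s z y" if "z \<in> V" "s \<in> {0..t}" for z s
      using q that y by (simp add: nonneg_fundamental_solution_def)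
    show "(\<Sum>y\<in>{y}. if z = y then 1 else 0) \<le> q 0 z y" if "z \<in> F" for z
      using q that y F by (auto simp: nonneg_fundamental_solution_def)
  qed (use x t in simp_all)
  then show ?thesis by simp
qed


section \<open>Existence of the heat kernel\<close>

text \<open>The value \<open>0\<close> off the domain is the one that
  \<open>nonneg_fundamental_solution\<close> prescribes, so the pointwise order can be used on the
  whole function type.\<close>

definition minimal_kernel :: "real \<Rightarrow> 'a \<Rightarrow> 'a \<Rightarrow> real"
  where "minimal_kernel t x y = (if 0 \<le> t \<and> x \<in> V \<and> y \<in> V
    then SUP F\<in>{F. finite F \<and> F \<subseteq> V}. dirichlet_kernel F t x y else 0)"

lemma dirichlet_kernel_le_minimal_kernel:
  assumes "finite F" "F \<subseteq> V" "x \<in> V" "y \<in> V" "0 \<le> t"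
  shows "dirichlet_kernel F t x y \<le> minimal_kernel t x y"
proof -
  have "dirichlet_kernel F t x y \<le> (SUP F\<in>{F. finite F \<and> F \<subseteq> V}. dirichlet_kernel F t x y)"
    by (rule cSUP_upper) (use assms in \<open>auto intro!: bdd_aboveI2[where M = 1] dirichlet_kernel_le_1\<close>)
  then show ?thesis using assms by (simp add: minimal_kernel_def)
qed

lemma minimal_kernel_le:
  assumes "x \<in> V" "y \<in> V" "0 \<le> t"
    and "\<And>F. finite F \<Longrightarrow> F \<subseteq> V \<Longrightarrow> dirichlet_kernel F t x y \<le> C"
  shows "minimal_kernel t x y \<le> C"
proof -
  have "(SUP F\<in>{F. finite F \<and> F \<subseteq> V}. dirichlet_kernel F t x y) \<le> C"
    by (rule cSUP_least) (use assms in auto)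
  then show ?thesis using assms by (simp add: minimal_kernel_def)
qed

text \<open>By monotonicity in \<open>F\<close> the supremum is a limit along growing finite sets,
  which allows passing to the limit in Laplacians and in sums.\<close>

lemma tendsto_minimal_kernel:
  assumes xyt: "x \<in> V" "y \<in> V" "0 \<le> t"
  shows "((\<lambda>F. dirichlet_kernel F t x y) \<longlongrightarrow> minimal_kernel t x y) (finite_subsets_at_top V)"
proof (rule increasing_tendsto)
  show "\<forall>\<^sub>F F in finite_subsets_at_top V. dirichlet_kernel F t x y \<le> minimal_kernel t x y"
    using xyt by (auto intro!: dirichlet_kernel_le_minimal_kernel)
  fix C assume C: "C < minimal_kernel t x y"
  obtain F where F: "finite F" "F \<subseteq> V" "C < dirichlet_kernel F t x y"
  proof (rule ccontr)
    assume "\<not> thesis"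
    with that have "minimal_kernel t x y \<le> C"
      by (intro minimal_kernel_le xyt) (meson not_less)
    with C show False by simp
  qed
  show "\<forall>\<^sub>F G in finite_subsets_at_top V. C < dirichlet_kernel G t x y"
    unfolding eventually_finite_subsets_at_top
    using F dirichlet_kernel_mono xyt by (intro exI[of _ F]) (auto intro: less_le_trans)
qed

lemma minimal_kernel_nonneg: "0 \<le> minimal_kernel t x y"
proof (cases "0 \<le> t \<and> x \<in> V \<and> y \<in> V")
  case True
  have "0 \<le> dirichlet_kernel {} t x y" using True by (simp add: dirichlet_kernel_nonneg)
  also have "\<dots> \<le> minimal_kernel t x y"
    using True by (intro dirichlet_kernel_le_minimal_kernel) auto
  finally show ?thesis .
qed (auto simp: minimal_kernel_def)

lemma minimal_kernel_sym: "minimal_kernel t x y = minimal_kernel t y x"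
proof -
  have "(SUP F\<in>{F. finite F \<and> F \<subseteq> V}. dirichlet_kernel F t x y) =
      (SUP F\<in>{F. finite F \<and> F \<subseteq> V}. dirichlet_kernel F t y x)"
    by (rule SUP_cong) (auto intro: dirichlet_kernel_sym)
  then show ?thesis by (simp add: minimal_kernel_def)
qed

lemma minimal_kernel_0:
  assumes "x \<in> V" "y \<in> V"
  shows "minimal_kernel 0 x y = (if x = y then 1 else 0)"
proof (rule antisym)
  show "minimal_kernel 0 x y \<le> (if x = y then 1 else 0)"
  proof (rule minimal_kernel_le)
    fix F assume "finite F" "F \<subseteq> V"
    then show "dirichlet_kernel F 0 x y \<le> (if x = y then 1 else 0)"
      using dirichlet_kernel_0[of F x y] dirichlet_kernel_outside[of F x y] by (cases "x \<in> F") auto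
  qed (use assms in auto)
  have "(if x = y then 1 else 0) = dirichlet_kernel {x} 0 x y"
    using assms by (simp add: dirichlet_kernel_0)
  also have "\<dots> \<le> minimal_kernel 0 x y"
    using assms by (intro dirichlet_kernel_le_minimal_kernel) auto
  finally show "(if x = y then 1 else 0) \<le> minimal_kernel 0 x y" .
qed

text \<open>The time derivatives of the Dirichlet kernels are finite sums, so they converge. Each
  difference in the Laplacian is Lipschitz in time with constant the sum of two valences, uniformly
  in \<open>F\<close>.\<close>

lemma minimal_kernel_deriv:
  assumes x: "x \<in> V" and y: "y \<in> V" and t: "0 \<le> t"
  shows "((\<lambda>s. minimal_kernel s x y) has_real_derivative
    - laplacian E (\<lambda>z. minimal_kernel t z y) x) (at t within {0..})"
proof (rule has_real_derivative_pointwise_limit[OF finite_subsets_at_top_neq_bot,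
      where f = "\<lambda>F s. dirichlet_kernel F s x y"
        and f' = "\<lambda>F s. - laplacian E (\<lambda>z. dirichlet_kernel F s z y) x"
        and C = "\<Sum>z | E x z. real (valence E x) + real (valence E z)" and t = t and S = "{0..}"])
  show "\<forall>\<^sub>F F in finite_subsets_at_top V. \<forall>s\<in>{0..}. ((\<lambda>s. dirichlet_kernel F s x y) has_real_derivative
      - laplacian E (\<lambda>z. dirichlet_kernel F s z y) x) (at s within {0..})"
    unfolding eventually_finite_subsets_at_top
    \<comment> \<open>The heat equation at \<open>x\<close> is available once \<open>F\<close>
      contains \<open>x\<close>.\<close>
    using x by (intro exI[of _ "{x}"]) (auto intro!: dirichlet_kernel_deriv)
  show "\<forall>\<^sub>F F in finite_subsets_at_top V. \<forall>s\<in>{0..}. \<bar>- laplacian E (\<lambda>z. dirichlet_kernel F s z y) x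
      - - laplacian E (\<lambda>z. dirichlet_kernel F t z y) x\<bar>
      \<le> (\<Sum>z | E x z. real (valence E x) + real (valence E z)) * \<bar>s - t\<bar>"
  proof (intro eventually_finite_subsets_at_top_weakI ballI)
    fix F and s :: real assume F: "finite F" "F \<subseteq> V" and s: "s \<in> {0..}"
    let ?d = "\<lambda>z. dirichlet_kernel F t z y - dirichlet_kernel F s z y"
    have d: "\<bar>?d z\<bar> \<le> valence E z * \<bar>s - t\<bar>" if "z \<in> V" for z
      using dirichlet_kernel_lipschitz[OF F that, of t s y] s t by (simp add: abs_minus_commute)
    have "\<bar>- laplacian E (\<lambda>z. dirichlet_kernel F s z y) x
        - - laplacian E (\<lambda>z. dirichlet_kernel F t z y) x\<bar> = \<bar>\<Sum>z | E x z. ?d x - ?d z\<bar>"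
      by (simp add: laplacian_def sum_subtractf sum.distrib algebra_simps)
    also have "\<dots> \<le> (\<Sum>z | E x z. \<bar>?d x - ?d z\<bar>)" by (rule sum_abs)
    also have "\<dots> \<le> (\<Sum>z | E x z. (real (valence E x) + real (valence E z)) * \<bar>s - t\<bar>)"
    proof (rule sum_mono)
      fix z assume "z \<in> {z. E x z}"
      then have "z \<in> V" using adj_in_V by auto
      then show "\<bar>?d x - ?d z\<bar> \<le> (real (valence E x) + real (valence E z)) * \<bar>s - t\<bar>"
        using d[OF x] d[of z] by (simp add: distrib_right)
    qed
    finally show "\<bar>- laplacian E (\<lambda>z. dirichlet_kernel F s z y) x
        - - laplacian E (\<lambda>z. dirichlet_kernel F t z y) x\<bar>
        \<le> (\<Sum>z | E x z. real (valence E x) + real (valence E z)) * \<bar>s - t\<bar>"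
      by (simp add: sum_distrib_right)
  qed
  show "((\<lambda>F. - laplacian E (\<lambda>z. dirichlet_kernel F t z y) x) \<longlongrightarrow>
      - laplacian E (\<lambda>z. minimal_kernel t z y) x) (finite_subsets_at_top V)"
    unfolding laplacian_def
    by (intro tendsto_intros tendsto_minimal_kernel) (use x y t adj_in_V in auto)
qed (use x y t in \<open>auto intro: tendsto_minimal_kernel\<close>)

text \<open>The Laplacian at a vertex is a finite sum and so commutes with the time derivative.
  Hence iterating minus the Laplacian on \<open>u t\<close> gives all time derivatives.\<close>

lemma smooth_on_nonneg_heat_solution:
  fixes u :: "real \<Rightarrow> 'a \<Rightarrow> real"
  assumes u: "\<And>z t. z \<in> V \<Longrightarrow> 0 \<le> t \<Longrightarrow>
      ((\<lambda>s. u s z) has_real_derivative - laplacian E (u t) z) (at t within {0..})"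
    and x: "x \<in> V"
  shows "smooth_on_nonneg (\<lambda>t. u t x)"
proof -
  define D where "D k t = ((\<lambda>f z. - laplacian E f z) ^^ k) (u t)" for k t
  have "((\<lambda>s. D k s z) has_real_derivative D (Suc k) t z) (at t within {0..})"
    if "z \<in> V" "0 \<le> t" for k z t
    using that(1)
  proof (induction k arbitrary: z)
    case 0
    then show ?case using u that(2) by (simp add: D_def)
  next
    case (Suc k)
    have D_Suc: "D (Suc j) s = (\<lambda>z. - laplacian E (D j s) z)" for j s
      by (simp add: D_def)
    have "((\<lambda>s. - laplacian E (D k s) z) has_real_derivative - laplacian E (D (Suc k) t) z)
        (at t within {0..})"
      using Suc by (intro DERIV_minus has_real_derivative_laplacian) auto
    then show ?case unfolding D_Suc[of "Suc k"] D_Suc[of k] .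
  qed
  moreover have "D 0 t x = u t x" for t by (simp add: D_def)
  ultimately show ?thesis
    unfolding smooth_on_nonneg_def using x by (intro exI[of _ "\<lambda>k t. D k t x"]) auto
qed

lemma nonneg_fundamental_solution_minimal_kernel:
  "nonneg_fundamental_solution V E minimal_kernel"
  unfolding nonneg_fundamental_solution_def
proof (intro conjI ballI allI impI)
  fix x y assume x: "x \<in> V" and y: "y \<in> V"
  show "smooth_on_nonneg (\<lambda>t. minimal_kernel t x y)"
    by (rule smooth_on_nonneg_heat_solution[OF minimal_kernel_deriv[OF _ y] x])
  fix t :: real assume t: "0 \<le> t"
  let ?p' = "- laplacian E (\<lambda>z. minimal_kernel t z y) x"
  have "((\<lambda>s. minimal_kernel s x y) has_real_derivative
      - laplacian E (\<lambda>z. minimal_kernel t z x) y) (at t within {0..})"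
    using minimal_kernel_deriv[OF y x t] by (simp add: minimal_kernel_sym[of _ y x])
  \<comment> \<open>Derivatives within \<open>{0..}\<close> are unique at limit points, also at
    \<open>t = 0\<close>; hence the Laplacians in the two variables agree.\<close>
  moreover have "t islimpt {0..}"
    by (rule islimpt_subset[OF islimpt_greaterThanLessThan1[of t "t + 1"]]) (use t in auto)
  ultimately have "?p' = - laplacian E (\<lambda>z. minimal_kernel t z x) y"
    using minimal_kernel_deriv[OF x y t]
    by (intro has_field_derivative_unique) (auto simp: trivial_limit_within)
  then have "laplacian E (\<lambda>z. minimal_kernel t x z) y + ?p' = 0"
    by (simp add: minimal_kernel_sym[of _ x])
  then show "\<exists>p'. ((\<lambda>s. minimal_kernel s x y) has_real_derivative p') (at t within {0..}) \<and>
      laplacian E (\<lambda>z. minimal_kernel t z y) x + p' = 0 \<and>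
      laplacian E (\<lambda>z. minimal_kernel t x z) y + p' = 0"
    using minimal_kernel_deriv[OF x y t] by (intro exI[of _ ?p']) simp
qed (auto simp: minimal_kernel_nonneg minimal_kernel_0, auto simp: minimal_kernel_def)

lemma heat_kernel_eq_minimal_kernel: "heat_kernel V E = minimal_kernel"
  unfolding heat_kernel_def
proof (rule Least_equality)
  fix q assume q: "nonneg_fundamental_solution V E q"
  show "minimal_kernel \<le> q"
    unfolding le_fun_def
  proof (intro allI)
    fix t x y
    show "minimal_kernel t x y \<le> q t x y"
    proof (cases "0 \<le> t \<and> x \<in> V \<and> y \<in> V")
      case True
      then show ?thesis
        by (intro minimal_kernel_le dirichlet_kernel_le_fundamental_solution[OF q]) auto
    next
      case False
      then show ?thesis
        using q unfolding nonneg_fundamental_solution_def by (auto simp: minimal_kernel_def)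
    qed
  qed
qed (rule nonneg_fundamental_solution_minimal_kernel)

section \<open>Criteria for stochastic completeness\<close>

text \<open>The mass missing from the kernel of a finite set is at most
  \<open>\<epsilon> * exp (l * s) * v z\<close>: this barrier is a supersolution and is at least
  \<open>1\<close> off a sublevel set of \<open>v\<close>.\<close>

lemma stochastically_completeI:
  assumes l: "0 \<le> l"
    and nonneg: "\<And>x. x \<in> V \<Longrightarrow> 0 \<le> v x"
    and growth: "\<And>x. x \<in> V \<Longrightarrow> - laplacian E v x \<le> l * v x"
    and proper: "\<And>C. finite {x \<in> V. v x \<le> C}"
  shows "stochastically_complete V E"
proof -
  have False if x: "x \<in> V" and t: "0 < t"
    and less: "(\<Sum>\<^sub>\<infinity>y\<in>V. ennreal (heat_kernel V E t x y)) < 1" for x t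
  proof -
    obtain r where r: "0 \<le> r" "(\<Sum>\<^sub>\<infinity>y\<in>V. ennreal (heat_kernel V E t x y)) = ennreal r"
      using less by (cases "\<Sum>\<^sub>\<infinity>y\<in>V. ennreal (heat_kernel V E t x y)" rule: ennreal_cases) auto
    then have r1: "r < 1" using less by simp
    define C where "C = exp (l * t) * v x"
    have C: "0 \<le> C" using nonneg[OF x] by (simp add: C_def)
    \<comment> \<open>Small enough that the barrier at \<open>x\<close> stays below the supposed
      deficit \<open>1 - r\<close>; the summand \<open>1\<close> keeps the denominator
      positive.\<close>
    define \<epsilon> where "\<epsilon> = (1 - r) / (2 * (C + 1))"
    have \<epsilon>: "0 < \<epsilon>" using r1 C by (simp add: \<epsilon>_def)
    \<comment> \<open>Off this set \<open>\<epsilon> * v\<close> exceeds \<open>1\<close>, which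
      makes up for the vanishing kernel.\<close>
    define F where "F = {x \<in> V. v x \<le> 1 / \<epsilon>}"
    have F: "finite F" "F \<subseteq> V" using proper by (auto simp: F_def)
    have "0 \<le> (\<Sum>y\<in>F. dirichlet_kernel F t x y) - 1 + \<epsilon> * exp (l * t) * v x"
    proof (rule minimum_principle[OF F, where T = t and
          u = "\<lambda>s z. (\<Sum>y\<in>F. dirichlet_kernel F s z y) - 1 + \<epsilon> * exp (l * s) * v z" and
          u' = "\<lambda>s z. (\<Sum>y\<in>F. - laplacian E (\<lambda>w. dirichlet_kernel F s w y) z) - 0 + \<epsilon> * (exp (l * s) * l) * v z"])
      fix z s assume z: "z \<in> F" and s: "s \<in> {0..t}"
      have "((\<lambda>s. exp (l * s)) has_real_derivative exp (l * s) * l) (at s within {0..t})"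
        by (auto intro!: derivative_eq_intros)
      then show "((\<lambda>s. (\<Sum>y\<in>F. dirichlet_kernel F s z y) - 1 + \<epsilon> * exp (l * s) * v z) has_real_derivative
          (\<Sum>y\<in>F. - laplacian E (\<lambda>w. dirichlet_kernel F s w y) z) - 0 + \<epsilon> * (exp (l * s) * l) * v z)
          (at s within {0..t})"
        by (intro DERIV_add DERIV_diff DERIV_sum DERIV_const DERIV_cmult_right DERIV_cmult
            dirichlet_kernel_deriv F z)
      have lap: "laplacian E (\<lambda>z. (\<Sum>y\<in>F. dirichlet_kernel F s z y) - 1 + \<epsilon> * exp (l * s) * v z) z =
          (\<Sum>y\<in>F. laplacian E (\<lambda>w. dirichlet_kernel F s w y) z) + \<epsilon> * exp (l * s) * laplacian E v z"
        using laplacian_diff[of "\<lambda>z. \<Sum>y\<in>F. dirichlet_kernel F s z y" "\<lambda>z. 1 - \<epsilon> * exp (l * s) * v z" z]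
          laplacian_diff[of "\<lambda>z. 1" "\<lambda>z. \<epsilon> * exp (l * s) * v z" z]
        by (simp add: laplacian_sum laplacian_const laplacian_cmult diff_diff_eq2 diff_add_eq)
      have "0 \<le> \<epsilon> * exp (l * s) * (l * v z + laplacian E v z)"
        using growth[of z] z F \<epsilon> by (intro mult_nonneg_nonneg) auto
      then show "0 \<le> (\<Sum>y\<in>F. - laplacian E (\<lambda>w. dirichlet_kernel F s w y) z) - 0 + \<epsilon> * (exp (l * s) * l) * v z
          + laplacian E (\<lambda>z. (\<Sum>y\<in>F. dirichlet_kernel F s z y) - 1 + \<epsilon> * exp (l * s) * v z) z"
        unfolding lap by (simp add: sum_negf algebra_simps)
    next
      fix z s assume z: "z \<in> V - F" and s: "s \<in> {0..t}"
      have "1 \<le> \<epsilon> * v z" using z \<epsilon> by (auto simp: F_def field_simps)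
      also have "\<dots> \<le> \<epsilon> * exp (l * s) * v z"
        using \<epsilon> nonneg[of z] z l s by (intro mult_right_mono) auto
      finally show "0 \<le> (\<Sum>y\<in>F. dirichlet_kernel F s z y) - 1 + \<epsilon> * exp (l * s) * v z"
        using z F by (simp add: dirichlet_kernel_outside)
    next
      fix z assume "z \<in> F"
      then show "0 \<le> (\<Sum>y\<in>F. dirichlet_kernel F 0 z y) - 1 + \<epsilon> * exp (l * 0) * v z"
        using F nonneg[of z] \<epsilon> by (auto simp: dirichlet_kernel_0)
    qed (use x t in auto)
    then have "1 - \<epsilon> * C \<le> (\<Sum>y\<in>F. dirichlet_kernel F t x y)"
      by (simp add: C_def)
    also have "\<dots> \<le> (\<Sum>y\<in>F. heat_kernel V E t x y)"
      unfolding heat_kernel_eq_minimal_kernel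
      using F x t by (intro sum_mono dirichlet_kernel_le_minimal_kernel) auto
    also have "\<dots> \<le> r"
    proof -
      have "ennreal (\<Sum>y\<in>F. heat_kernel V E t x y) = (\<Sum>y\<in>F. ennreal (heat_kernel V E t x y))"
        by (simp add: heat_kernel_eq_minimal_kernel minimal_kernel_nonneg)
      also have "\<dots> \<le> (\<Sum>\<^sub>\<infinity>y\<in>V. ennreal (heat_kernel V E t x y))"
        by (subst nonneg_infsum_complete) (use F in \<open>auto intro: SUP_upper\<close>)
      finally show ?thesis using r by simp
    qed
    finally have "1 - \<epsilon> * C \<le> r" .
    moreover have "\<epsilon> * C < 1 - r"
    proof -
      have "\<epsilon> * C \<le> \<epsilon> * (C + 1)" using \<epsilon> by simp
      also have "\<dots> = (1 - r) / 2" using C by (simp add: \<epsilon>_def field_simps)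
      also have "\<dots> < 1 - r" using r1 by simp
      finally show ?thesis .
    qed
    ultimately show False by linarith
  qed
  then show ?thesis
    unfolding stochastically_complete_def stochastically_incomplete_def by blast
qed

text \<open>The bounds on \<open>v\<close> give a supersolution \<open>\<psi>\<close> that starts at
  or above \<open>1\<close> and falls below \<open>1\<close> while it is still nonnegative.\<close>

lemma stochastically_incompleteI:
  assumes c: "0 < c"
    and nonneg: "\<And>x. x \<in> V \<Longrightarrow> 0 \<le> v x"
    and bounded: "\<And>x. x \<in> V \<Longrightarrow> v x \<le> N"
    and growth: "\<And>x. x \<in> V \<Longrightarrow> c \<le> - laplacian E v x"
  shows "stochastically_incomplete V E"
proof -
  obtain x where x: "x \<in> V" using infinite_V by fastforce
  have N: "0 \<le> N" using nonneg[OF x] bounded[OF x] by linarith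
  \<comment> \<open>As \<open>v\<close> is at most \<open>N\<close>, \<open>\<psi>\<close> is
    nonnegative up to this time, where its value is \<open>1 - (v z + 1) / (N + 1)\<close>.\<close>
  define T where "T = (N + 1) / c"
  have T: "0 < T" and cT: "c * T = N + 1" using N c by (simp_all add: T_def)
  \<comment> \<open>The decay in time at rate \<open>c / (N + 1)\<close> is balanced by the
    Laplacian of \<open>- v / (N + 1)\<close>.\<close>
  define \<psi> where "\<psi> s z = 1 + (N - v z - c * s) / (N + 1)" for s z
  have lap: "laplacian E (\<psi> s) z = - laplacian E v z / (N + 1)" for s z
    by (simp add: \<psi>_def laplacian_def sum_divide_distrib diff_divide_distrib flip: sum_negf)
  \<comment> \<open>\<open>G\<close> stays fixed while \<open>F\<close> grows to \<open>V\<close>;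
    the supremum over \<open>G\<close> is taken only afterwards.\<close>
  have finite_mass: "(\<Sum>y\<in>G. heat_kernel V E T x y) \<le> \<psi> T x" if G: "finite G" "G \<subseteq> V" for G
  proof (rule tendsto_upperbound)
    show "((\<lambda>F. \<Sum>y\<in>G. dirichlet_kernel F T x y) \<longlongrightarrow> (\<Sum>y\<in>G. heat_kernel V E T x y))
        (finite_subsets_at_top V)"
      unfolding heat_kernel_eq_minimal_kernel
      using G x T by (intro tendsto_sum tendsto_minimal_kernel) auto
    show "\<forall>\<^sub>F F in finite_subsets_at_top V. (\<Sum>y\<in>G. dirichlet_kernel F T x y) \<le> \<psi> T x"
    proof (rule eventually_finite_subsets_at_top_weakI)
      fix F assume F: "finite F" "F \<subseteq> V"
      show "(\<Sum>y\<in>G. dirichlet_kernel F T x y) \<le> \<psi> T x"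
      proof (rule dirichlet_kernel_le_supersolution[OF F, where T = T and u = \<psi> and
            u' = "\<lambda>s z. - c / (N + 1)"])
        fix z s assume z: "z \<in> F"
        show "((\<lambda>s. \<psi> s z) has_real_derivative - c / (N + 1)) (at s within {0..T})"
          unfolding \<psi>_def using N by (auto intro!: derivative_eq_intros)
        have "c / (N + 1) \<le> - laplacian E v z / (N + 1)"
          using growth[of z] z F N by (intro divide_right_mono) auto
        then show "0 \<le> - c / (N + 1) + laplacian E (\<psi> s) z" by (simp add: lap)
      next
        fix z s assume z: "z \<in> V" and s: "s \<in> {0..T}"
        have "c * s \<le> N + 1" using s c mult_left_mono[of s T c] by (simp add: cT)
        then show "0 \<le> \<psi> s z" using N bounded[OF z] by (simp add: \<psi>_def field_simps)
      next
        fix z assume "z \<in> F"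
        then have "1 \<le> \<psi> 0 z" using bounded[of z] F N by (auto simp: \<psi>_def)
        then show "(\<Sum>y\<in>G. if z = y then 1 else 0) \<le> \<psi> 0 z"
          using G by (auto simp: sum.delta')
      qed (use x T in auto)
    qed
  qed simp
  have "(\<Sum>\<^sub>\<infinity>y\<in>V. ennreal (heat_kernel V E T x y)) \<le> ennreal (\<psi> T x)"
  proof (subst nonneg_infsum_complete)
    show "(SUP G\<in>{G. finite G \<and> G \<subseteq> V}. \<Sum>y\<in>G. ennreal (heat_kernel V E T x y)) \<le> ennreal (\<psi> T x)"
      using finite_mass
      by (intro SUP_least)
        (auto simp: heat_kernel_eq_minimal_kernel minimal_kernel_nonneg intro!: ennreal_leI)
  qed simp
  also have "\<psi> T x < 1" using N nonneg[OF x] by (simp add: \<psi>_def cT divide_less_eq)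
  then have "ennreal (\<psi> T x) < 1"
    using ennreal_less_one_iff by blast
  finally show ?thesis unfolding stochastically_incomplete_def using x T by blast
qed


end

section \<open>Model trees\<close>

context infinite_graph
begin

context
  fixes w :: 'a
  assumes w: "w \<in> V"
begin

lemma relpowp_graph_dist: "x \<in> V \<Longrightarrow> (E ^^ graph_dist E x w) x w"
  unfolding graph_dist_def using connected[OF _ w, of x] by (auto simp: rtranclp_power intro: LeastI)

lemma graph_dist_le: "(E ^^ k) x w \<Longrightarrow> graph_dist E x w \<le> k"
  unfolding graph_dist_def by (rule Least_le)

lemma graph_dist_adj:
  assumes "E x y"
  shows "graph_dist E x w \<le> Suc (graph_dist E y w)"
proof -
  have "(E ^^ Suc (graph_dist E y w)) x w"
    using assms relpowp_graph_dist[of y] adj_in_V[OF assms] by (intro relpowp_Suc_I2) auto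
  then show ?thesis by (rule graph_dist_le)
qed

lemma graph_dist_eq_0_iff: "x \<in> V \<Longrightarrow> graph_dist E x w = 0 \<longleftrightarrow> x = w"
  using relpowp_graph_dist[of x] graph_dist_le[of 0 x] by auto

lemma graph_dist_SucE:
  assumes "x \<in> V" "graph_dist E x w = Suc r"
  obtains y where "E x y" "graph_dist E y w = r"
proof -
  have "(E ^^ Suc r) x w" using relpowp_graph_dist[OF assms(1)] assms(2) by simp
  then obtain y where y: "E x y" "(E ^^ r) y w" by (rule relpowp_Suc_E2)
  have "graph_dist E y w = r"
    using graph_dist_le[OF y(2)] graph_dist_adj[OF y(1)] assms(2) by simp
  with y(1) show thesis by (rule that)
qed

text \<open>Every vertex of the next sphere is adjacent to a vertex of the ball, so local finiteness
  carries the induction.\<close>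

lemma finite_ball: "finite {x \<in> V. graph_dist E x w \<le> r}"
proof (induction r)
  case 0
  show ?case
    by (rule finite_subset[of _ "{w}"]) (auto simp: graph_dist_eq_0_iff)
next
  case (Suc r)
  let ?B = "{x \<in> V. graph_dist E x w \<le> r}"
  have "{x \<in> V. graph_dist E x w \<le> Suc r} \<subseteq> ?B \<union> (\<Union>y\<in>?B. {x. E y x})"
  proof
    fix x assume x: "x \<in> {x \<in> V. graph_dist E x w \<le> Suc r}"
    show "x \<in> ?B \<union> (\<Union>y\<in>?B. {x. E y x})"
    proof (cases "graph_dist E x w = Suc r")
      case True
      then obtain y where "E x y" "graph_dist E y w = r" using x graph_dist_SucE by blast
      then show ?thesis using adj_sym[of x y] adj_in_V[of x y] by auto
    qed (use x in auto)
  qed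
  then show ?case by (rule finite_subset) (use Suc locally_finite in auto)
qed

text \<open>Balls are finite and \<open>V\<close> is not, so some vertex lies farther out; a descent
  towards \<open>w\<close> meets every smaller distance.\<close>

lemma sphere_at_nonempty: "sphere_at V E w r \<noteq> {}"
proof -
  have "V \<noteq> {x \<in> V. graph_dist E x w \<le> r}" using finite_ball[of r] infinite_V by metis
  then obtain x where x: "x \<in> V" "r \<le> graph_dist E x w" by force
  from x have "\<exists>y\<in>V. graph_dist E y w = r"
  proof (induction "graph_dist E x w - r" arbitrary: x)
    case 0
    then show ?case by force
  next
    case (Suc k)
    then obtain q where q: "graph_dist E x w = Suc q" "r \<le> q" by (cases "graph_dist E x w") auto
    obtain y where "E x y" "graph_dist E y w = q" using Suc q graph_dist_SucE by blast
    then show ?case using Suc(1)[of y] Suc(2) q adj_in_V by auto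
  qed
  then show ?thesis unfolding sphere_at_def by blast
qed

end

end

section \<open>Parents and children in a tree\<close>

context infinite_tree
begin

context
  fixes w :: 'a
  assumes w: "w \<in> V"
begin

text \<open>The path follows both vertices towards the root until the two lines of ancestors meet.\<close>

lemma path_below_level:
  assumes "x \<in> V" "y \<in> V" "x \<noteq> y" "graph_dist E x w = r" "graph_dist E y w = r"
  shows "\<exists>xs. 3 \<le> length xs \<and> distinct xs \<and> successively E xs \<and> hd xs = x \<and> last xs = y \<and>
    (\<forall>z\<in>set xs. graph_dist E z w \<le> r)"
  using assms
proof (induction r arbitrary: x y)
  case 0
  then show ?case using graph_dist_eq_0_iff[OF w] by auto
next
  case (Suc r)
  obtain x' where x': "E x x'" "graph_dist E x' w = r"
    using graph_dist_SucE[OF w] Suc.prems by blast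
  obtain y' where y': "E y y'" "graph_dist E y' w = r"
    using graph_dist_SucE[OF w] Suc.prems by blast
  show ?case
  proof (cases "x' = y'")
    case True
    have "x \<noteq> x'" "y \<noteq> x'" using x' y' adj_irrefl True by auto
    then show ?thesis
      using x' y' Suc.prems adj_sym[OF y'(1)] True by (intro exI[of _ "[x, x', y]"]) auto
  next
    case False
    then obtain xs where xs: "3 \<le> length xs" "distinct xs" "successively E xs" "hd xs = x'"
        "last xs = y'" "\<forall>z\<in>set xs. graph_dist E z w \<le> r"
      using Suc.IH[of x' y'] x' y' adj_in_V by blast
    \<comment> \<open>The two ends lie one level above the whole inner path, so adding them keeps
      the vertices distinct.\<close>
    have "x \<notin> set xs" "y \<notin> set xs" using xs(6) Suc.prems by auto
    moreover have "xs \<noteq> []" using xs(1) by auto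
    ultimately show ?thesis
      using xs x' Suc.prems adj_sym[OF y'(1)]
      by (intro exI[of _ "x # xs @ [y]"])
        (auto simp: successively_Cons successively_append_iff le_Suc_eq)
  qed
qed

text \<open>An edge within a sphere would close the path of \<open>path_below_level\<close> to a
  cycle.\<close>

lemma graph_dist_adj_neq:
  assumes "E x y"
  shows "graph_dist E x w \<noteq> graph_dist E y w"
proof
  assume eq: "graph_dist E x w = graph_dist E y w"
  have "x \<noteq> y" using assms adj_irrefl by blast
  then obtain xs where "3 \<le> length xs" "distinct xs" "successively E xs" "hd xs = x" "last xs = y"
    using path_below_level[of x y "graph_dist E y w"] eq assms adj_in_V by blast
  then have "is_cycle E xs" using adj_sym[OF assms] by (simp add: is_cycle_def)
  then show False using acyclic by blast
qed

text \<open>Two parents would be joined by a path of levels at most \<open>r\<close>; the vertex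
  \<open>x\<close>, one level higher, would close it to a cycle.\<close>

lemma parent_unique:
  assumes x: "graph_dist E x w = Suc r"
    and y: "E x y" "graph_dist E y w = r" and z: "E x z" "graph_dist E z w = r"
  shows "y = z"
proof (rule ccontr)
  assume "y \<noteq> z"
  then obtain xs where xs: "3 \<le> length xs" "distinct xs" "successively E xs" "hd xs = y" "last xs = z"
      "\<forall>z\<in>set xs. graph_dist E z w \<le> r"
    using path_below_level[of y z r] y z adj_in_V by blast
  have "x \<notin> set xs" using xs(6) x by auto
  moreover have "xs \<noteq> []" using xs(1) by auto
  ultimately have "is_cycle E (x # xs)"
    using xs y adj_sym[OF z(1)] by (auto simp: is_cycle_def successively_Cons)
  then show False using acyclic by blast
qed

lemma root_neighbours: "{y. E w y} = {y. E w y \<and> graph_dist E y w = 1}"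
proof -
  have "graph_dist E y w = 1" if "E w y" for y
    using graph_dist_adj[OF w adj_sym[OF that]] graph_dist_adj_neq[OF that]
      graph_dist_eq_0_iff[OF w w] by simp
  then show ?thesis by blast
qed

lemma nonroot_neighboursE:
  assumes "x \<in> V" "graph_dist E x w = Suc r"
  obtains p where "p \<in> V" "graph_dist E p w = r"
    "{y. E x y} = insert p {y. E x y \<and> graph_dist E y w = Suc (Suc r)}"
proof -
  obtain p where p: "E x p" "graph_dist E p w = r" using graph_dist_SucE[OF w assms] by blast
  have "graph_dist E y w = Suc (Suc r) \<or> y = p" if "E x y" for y
  proof -
    \<comment> \<open>Levels of adjacent vertices differ by at most one and are never equal.\<close>
    have "graph_dist E y w = r \<or> graph_dist E y w = Suc (Suc r)"
      using graph_dist_adj[OF w that] graph_dist_adj[OF w adj_sym[OF that]]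
        graph_dist_adj_neq[OF that] assms(2) by linarith
    then show ?thesis using parent_unique[OF assms(2) that _ p] by blast
  qed
  then have "{y. E x y} = insert p {y. E x y \<and> graph_dist E y w = Suc (Suc r)}"
    using p(1) by blast
  then show thesis using that p adj_in_V by blast
qed

end

end

section \<open>Radial functions on a model tree\<close>

context model_tree
begin

context
  fixes n :: "nat \<Rightarrow> nat"
  assumes n: "branching_function V E x\<^sub>0 n"
begin

text \<open>At the root every neighbour is a child; elsewhere exactly one neighbour is the parent,
  which accounts for the \<open>- 1\<close> in the branching function.\<close>

lemma card_children:
  assumes x: "x \<in> V"
  shows "card {y. E x y \<and> graph_dist E y x\<^sub>0 = Suc (graph_dist E x x\<^sub>0)} = n (graph_dist E x x\<^sub>0)"
proof (cases "graph_dist E x x\<^sub>0")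
  case 0
  then have "x = x\<^sub>0" using graph_dist_eq_0_iff[OF root_in_V x] by simp
  then show ?thesis
    using n root_neighbours[OF root_in_V] 0 by (simp add: branching_function_def valence_def)
next
  case (Suc r)
  obtain p where p: "graph_dist E p x\<^sub>0 = r"
      "{y. E x y} = insert p {y. E x y \<and> graph_dist E y x\<^sub>0 = Suc (Suc r)}"
    using nonroot_neighboursE[OF root_in_V x Suc] by blast
  have "finite {y. E x y \<and> graph_dist E y x\<^sub>0 = Suc (Suc r)}"
    by (rule finite_subset[OF _ locally_finite[OF x]]) auto
  then have "valence E x = Suc (card {y. E x y \<and> graph_dist E y x\<^sub>0 = Suc (Suc r)})"
    unfolding valence_def p(2) using p(1) by simp
  moreover have "n (Suc r) = valence E x - 1"
    using n x Suc by (auto simp: branching_function_def sphere_at_def)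
  ultimately show ?thesis using Suc by simp
qed

text \<open>The parent of a vertex in the next sphere has a child. Hence no reciprocal
  \<open>1 / real (n r)\<close> is the default value \<open>1 / 0 = 0\<close>.\<close>

lemma branching_function_pos: "1 \<le> n r"
proof -
  obtain x where x: "x \<in> V" "graph_dist E x x\<^sub>0 = Suc r"
    using sphere_at_nonempty[OF root_in_V, of "Suc r"] by (auto simp: sphere_at_def)
  obtain p where p: "E x p" "graph_dist E p x\<^sub>0 = r" using graph_dist_SucE[OF root_in_V x] by blast
  have pV: "p \<in> V" using p adj_in_V by blast
  have "x \<in> {y. E p y \<and> graph_dist E y x\<^sub>0 = Suc (graph_dist E p x\<^sub>0)}"
    using x p adj_sym by auto
  moreover have "finite {y. E p y \<and> graph_dist E y x\<^sub>0 = Suc (graph_dist E p x\<^sub>0)}"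
    by (rule finite_subset[OF _ locally_finite[OF pV]]) auto
  ultimately have "card {y. E p y \<and> graph_dist E y x\<^sub>0 = Suc (graph_dist E p x\<^sub>0)} > 0"
    using card_gt_0_iff by blast
  then show ?thesis using card_children[OF pV] p by simp
qed

text \<open>The children contribute equal outward increments and the single parent one inward
  increment; the root has no parent.\<close>

lemma laplacian_radial:
  fixes f :: "nat \<Rightarrow> real"
  assumes x: "x \<in> V"
  shows "- laplacian E (\<lambda>y. f (graph_dist E y x\<^sub>0)) x =
    (case graph_dist E x x\<^sub>0 of
      0 \<Rightarrow> n 0 * (f 1 - f 0)
    | Suc r \<Rightarrow> n (Suc r) * (f (Suc (Suc r)) - f (Suc r)) - (f (Suc r) - f r))"
proof (cases "graph_dist E x x\<^sub>0")
  case 0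
  then have x0: "x = x\<^sub>0" using graph_dist_eq_0_iff[OF root_in_V x] by simp
  let ?C = "{y. E x\<^sub>0 y \<and> graph_dist E y x\<^sub>0 = 1}"
  have "laplacian E (\<lambda>y. f (graph_dist E y x\<^sub>0)) x = (\<Sum>y\<in>?C. f 0 - f 1)"
    unfolding laplacian_def x0 root_neighbours[OF root_in_V] by (rule sum.cong) (use 0 x0 in auto)
  also have "\<dots> = n 0 * (f 0 - f 1)"
    using card_children[OF x] 0 x0 by simp
  finally show ?thesis using 0 by (simp add: algebra_simps)
next
  case (Suc r)
  let ?C = "{y. E x y \<and> graph_dist E y x\<^sub>0 = Suc (Suc r)}"
  obtain p where p: "graph_dist E p x\<^sub>0 = r" "{y. E x y} = insert p ?C"
    using nonroot_neighboursE[OF root_in_V x Suc] by blast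
  have "finite ?C" by (rule finite_subset[OF _ locally_finite[OF x]]) auto
  moreover have "p \<notin> ?C" using p(1) by simp
  ultimately have "laplacian E (\<lambda>y. f (graph_dist E y x\<^sub>0)) x =
      (f (Suc r) - f r) + (\<Sum>y\<in>?C. f (graph_dist E x x\<^sub>0) - f (graph_dist E y x\<^sub>0))"
    unfolding laplacian_def p(2) using p(1) Suc by (subst sum.insert) auto
  also have "(\<Sum>y\<in>?C. f (graph_dist E x x\<^sub>0) - f (graph_dist E y x\<^sub>0)) = (\<Sum>y\<in>?C. f (Suc r) - f (Suc (Suc r)))"
    by (rule sum.cong) (use Suc in auto)
  also have "\<dots> = n (Suc r) * (f (Suc r) - f (Suc (Suc r)))"
    using card_children[OF x] Suc by simp
  finally show ?thesis using Suc by (simp add: algebra_simps)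
qed

lemma stochastically_complete_of_not_summable:
  assumes "\<not> summable (\<lambda>r. 1 / real (n r))"
  shows "stochastically_complete V E"
proof -
  \<comment> \<open>The outward term of the Laplacian becomes \<open>1\<close> and the inward one
    lowers it, so the result is at most \<open>1\<close>. The leading summand \<open>1\<close> turns
    this into a bound by \<open>v\<close> itself.\<close>
  define v where "v r = 1 + (\<Sum>i<r. 1 / real (n i))" for r
  have v_mono: "v r \<le> v (Suc r)" for r by (simp add: v_def)
  have v1: "1 \<le> v r" for r by (auto simp: v_def intro: sum_nonneg)
  have n_v: "n r * (v (Suc r) - v r) = 1" for r
    using branching_function_pos[of r] by (simp add: v_def)
  show ?thesis
  proof (rule stochastically_completeI[where l = 1 and v = "\<lambda>x. v (graph_dist E x x\<^sub>0)"])
    fix x assume x: "x \<in> V"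
    show "0 \<le> v (graph_dist E x x\<^sub>0)" using v1[of "graph_dist E x x\<^sub>0"] by linarith
    have "- laplacian E (\<lambda>x. v (graph_dist E x x\<^sub>0)) x \<le> 1"
      unfolding laplacian_radial[OF x]
      using n_v n_v[of 0] v_mono by (auto split: nat.split)
    then show "- laplacian E (\<lambda>x. v (graph_dist E x x\<^sub>0)) x \<le> 1 * v (graph_dist E x x\<^sub>0)"
      using v1[of "graph_dist E x x\<^sub>0"] by linarith
  next
    fix C
    \<comment> \<open>Divergence enters here: as \<open>v\<close> is unbounded and monotone, its
      sublevel sets lie in balls.\<close>
    have "\<exists>R. C < v R"
    proof (rule ccontr)
      assume "\<nexists>R. C < v R"
      then have "v R \<le> C" for R by (simp add: not_less)
      then have "(\<Sum>i<R. 1 / real (n i)) \<le> C - 1" for R unfolding v_def by (simp add: algebra_simps)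
      then have "summable (\<lambda>r. 1 / real (n r))"
        by (intro summableI_nonneg_bounded[of _ "C - 1"]) auto
      with assms show False by blast
    qed
    then obtain R where R: "C < v R" ..
    have "mono v" by (rule incseq_SucI) (rule v_mono)
    then have "k \<le> R" if "v k \<le> C" for k
      using R that monoD[of v R k] by (cases "k \<le> R") auto
    then have "{x \<in> V. v (graph_dist E x x\<^sub>0) \<le> C} \<subseteq> {x \<in> V. graph_dist E x x\<^sub>0 \<le> R}"
      by blast
    then show "finite {x \<in> V. v (graph_dist E x x\<^sub>0) \<le> C}"
      by (rule finite_subset) (rule finite_ball[OF root_in_V])
  qed simp
qed

lemma stochastically_incomplete_of_summable:
  assumes "summable (\<lambda>r. 1 / real (n r))"
  shows "stochastically_incomplete V E"
proof -
  \<comment> \<open>With weight \<open>1\<close> in place of \<open>M\<close>, minus the Laplacian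
    at level \<open>Suc r\<close> would be \<open>1 - 1 / n r\<close>, which is \<open>0\<close> if
    \<open>n r = 1\<close>. The growing weight repairs this and stays bounded by
    \<open>1 + B\<close>.\<close>
  define M where "M r = 1 + (\<Sum>i<r. 1 / real (n i))" for r
  define v where "v r = (\<Sum>i<r. M i / real (n i))" for r
  define B where "B = (\<Sum>i. 1 / real (n i))"
  have n1: "1 \<le> real (n r)" for r using branching_function_pos[of r] by simp
  have sum_le: "(\<Sum>i<r. 1 / real (n i)) \<le> B" for r
    unfolding B_def by (rule sum_le_suminf[OF assms]) auto
  have M1: "1 \<le> M r" for r by (auto simp: M_def intro: sum_nonneg)
  have v_Suc: "n r * (v (Suc r) - v r) = M r" for r using n1[of r] by (simp add: v_def)
  show ?thesis
  proof (rule stochastically_incompleteI[where c = "1 / 2" and N = "(1 + B) * B" and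
        v = "\<lambda>x. v (graph_dist E x x\<^sub>0)"])
    fix x assume x: "x \<in> V"
    have "0 \<le> M r" for r using M1[of r] by linarith
    then show "0 \<le> v (graph_dist E x x\<^sub>0)" by (auto simp: v_def intro: sum_nonneg)
    have "v r \<le> (1 + B) * B" for r
    proof -
      have "v r \<le> (\<Sum>i<r. (1 + B) * (1 / real (n i)))"
        unfolding v_def using sum_le by (intro sum_mono) (simp add: M_def divide_right_mono)
      also have "\<dots> = (1 + B) * (\<Sum>i<r. 1 / real (n i))" by (simp add: sum_distrib_left)
      \<comment> \<open>The empty partial sum \<open>sum_le[of 0]\<close> shows that
        \<open>B\<close> is nonnegative.\<close>
      also have "\<dots> \<le> (1 + B) * B" using sum_le[of 0] by (intro mult_left_mono sum_le) auto
      finally show ?thesis .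
    qed
    then show "v (graph_dist E x x\<^sub>0) \<le> (1 + B) * B" .
    have "1 / 2 \<le> M (Suc r) - (v (Suc r) - v r)" for r
    \<comment> \<open>If \<open>n r = 1\<close>, the increase of \<open>M\<close> supplies the whole
      value \<open>1\<close>; otherwise the inward term takes away at most half of
      \<open>M r\<close>.\<close>
    proof (cases "n r = 1")
      case True
      then show ?thesis by (simp add: M_def v_def)
    next
      case False
      then have "2 \<le> real (n r)" using branching_function_pos[of r] by simp
      then have "M r / real (n r) \<le> M r / 2" using M1[of r] by (intro divide_left_mono) auto
      moreover have "M r \<le> M (Suc r)" by (simp add: M_def)
      ultimately show ?thesis using M1[of r] by (simp add: v_def)
    qed
    then show "1 / 2 \<le> - laplacian E (\<lambda>x. v (graph_dist E x x\<^sub>0)) x"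
      unfolding laplacian_radial[OF x] using v_Suc M1[of 0] v_Suc[of 0]
      by (auto split: nat.split)
  qed simp
qed

end

end

theorem theorem3p2p1:
  fixes V :: "'a set" and E :: "'a \<Rightarrow> 'a \<Rightarrow> bool" and x\<^sub>0 :: 'a and n :: "nat \<Rightarrow> nat"
  assumes "model_tree V E x\<^sub>0"
    and "branching_function V E x\<^sub>0 n"
  shows "stochastically_complete V E \<longleftrightarrow> (\<Sum>r. ennreal (1 / real (n r))) = \<infinity>"
proof -
  interpret model_tree V E x\<^sub>0 by fact
  let ?S = "\<Sum>r. ennreal (1 / real (n r))"
  show ?thesis
  \<comment> \<open>For nonnegative terms, real summability is the same as finiteness of the sum in
    \<open>ennreal\<close>.\<close>
  proof (cases "summable (\<lambda>r. 1 / real (n r))")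
    case True
    then have "?S \<noteq> top" by (rule ennreal_suminf_neq_top) simp
    with stochastically_incomplete_of_summable[OF assms(2) True] show ?thesis
      unfolding stochastically_complete_def infinity_ennreal_def by blast
  next
    case False
    then have "?S = top" using summable_suminf_not_top[of "\<lambda>r. 1 / real (n r)"] by fastforce
    with stochastically_complete_of_not_summable[OF assms(2) False] show ?thesis
      unfolding infinity_ennreal_def by blast
  qed
qed

end
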